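(* Let $t$ be a positive integer. If $G$ is a connected graph of order $n\geq 4t^2+6t+2$ with $\rho(G)\geq\rho(K_{2t-1}\nabla(K_{n-2t}\cup K_{1}))$, then $G$ is a $t$-tough graph, unless $G\cong K_{2t-1}\nabla(K_{n-2t}\cup K_{1})$.
   Context: Graphs are finite, simple and undirected. For a graph $G$, $A(G)$ is its adjacency matrix and $\rho(G)$, the spectral radius of $G$, is the largest eigenvalue of $A(G)$. $c(G)$ denotes the number of connected components of $G$. For a real number $t$, a graph $G$ is $t$-tough if $|S|\geq t\,c(G-S)$ for every subset $S\subseteq V(G)$ with $c(G-S)>1$ (so complete graphs are $t$-tough for every $t$). $K_m$ is the complete graph on $m$ vertices, $\cup$ denotes disjoint union, and $G_1\nabla G_2$ is the join of $G_1$ and $G_2$, obtained from their disjoint union by adding all edges between $V(G_1)$ and $V(G_2)$. *)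

theory Defs
  imports
    "Graph_Theory.Graph_Theory"
    "Jordan_Normal_Form.Spectral_Radius"
begin

text \<open>
  A finite simple undirected graph is a digraph in the locale \<open>graph\<close> of \<open>Graph_Theory\<close>:
  finite, loop-free, without parallel arcs, and with a symmetric adjacency relation
  \<open>arcs_ends\<close>. An undirected edge is thus represented by a pair of opposite arcs.
\<close>

subsection \<open>Spectral radius\<close>

definition vertex_enum :: "('a, 'b) pre_digraph \<Rightarrow> nat \<Rightarrow> 'a" where
  "vertex_enum G = (SOME e. bij_betw e {0..<card (verts G)} (verts G))"

text \<open>
  The rows and columns are numbered by an arbitrary enumeration of the vertices. The spectrum does
  not depend on its choice, see \<open>eigenvalue_adjacency_matrix_iff\<close> below.
\<close>
definition adjacency_matrix :: "('a, 'b) pre_digraph \<Rightarrow> real mat" where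
  "adjacency_matrix G = mat (card (verts G)) (card (verts G))
     (\<lambda>(i, j). if vertex_enum G i \<rightarrow>\<^bsub>G\<^esub> vertex_enum G j then 1 else 0)"

text \<open>
  The matrix has real entries, so \<open>spectrum\<close> is the set of its real eigenvalues; for a graph
  it is symmetric, so these are all of its eigenvalues.
\<close>
definition graph_spectral_radius :: "('a, 'b) pre_digraph \<Rightarrow> real" where
  "graph_spectral_radius G = Max (spectrum (adjacency_matrix G))"

subsection \<open>Toughness\<close>

text \<open>Connected graphs are nonempty in \<open>Graph_Theory\<close>; the null graph has no component.\<close>
definition num_components :: "('a, 'b) pre_digraph \<Rightarrow> nat" where
  "num_components G = card {H. pre_digraph.max_subgraph G Digraph_Component.connected H}"

definition tough :: "real \<Rightarrow> ('a, 'b) pre_digraph \<Rightarrow> bool" where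
  "tough t G \<longleftrightarrow> (\<forall>S \<subseteq> verts G. num_components (G \<restriction> (verts G - S)) > 1 \<longrightarrow>
     real (card S) \<ge> t * real (num_components (G \<restriction> (verts G - S))))"

subsection \<open>Complete graphs, disjoint unions and joins\<close>

definition complete_graph :: "nat \<Rightarrow> nat pair_pre_digraph" where
  "complete_graph m =
     \<lparr> pverts = {0..<m}, parcs = {(u, v). u \<in> {0..<m} \<and> v \<in> {0..<m} \<and> u \<noteq> v} \<rparr>"

definition disjoint_union ::
    "'a pair_pre_digraph \<Rightarrow> 'b pair_pre_digraph \<Rightarrow> ('a + 'b) pair_pre_digraph" where
  "disjoint_union G H =
     \<lparr> pverts = pverts G <+> pverts H,
       parcs = map_prod Inl Inl ` parcs G \<union> map_prod Inr Inr ` parcs H \<rparr>"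

definition graph_join ::
    "'a pair_pre_digraph \<Rightarrow> 'b pair_pre_digraph \<Rightarrow> ('a + 'b) pair_pre_digraph" where
  "graph_join G H =
     \<lparr> pverts = pverts G <+> pverts H,
       parcs = parcs (disjoint_union G H)
         \<union> (Inl ` pverts G) \<times> (Inr ` pverts H) \<union> (Inr ` pverts H) \<times> (Inl ` pverts G) \<rparr>"

text \<open>
  \<open>extremal_graph t n\<close> is $K_{2t-1} \nabla (K_{n-2t} \cup K_1)$. The subtractions are on natural
  numbers, so it is meaningful only for \<open>t \<ge> 1\<close> and \<open>n \<ge> 2 * t\<close>.
\<close>
definition extremal_graph :: "nat \<Rightarrow> nat \<Rightarrow> (nat + (nat + nat)) pair_pre_digraph" where
  "extremal_graph t n =
     graph_join (complete_graph (2 * t - 1))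
       (disjoint_union (complete_graph (n - 2 * t)) (complete_graph 1))"

subsection \<open>Basic properties\<close>

lemma pair_graph_complete_graph: "pair_graph (complete_graph m)"
  by unfold_locales (auto simp: complete_graph_def symmetric_def sym_def
      intro: finite_subset[of _ "{0..<m} \<times> {0..<m}"])

lemma pair_graph_disjoint_union:
  assumes "pair_graph G" "pair_graph H"
  shows "pair_graph (disjoint_union G H)"
proof -
  interpret G: pair_graph G by fact
  interpret H: pair_graph H by fact
  show ?thesis
    using G.pair_sym_arcs H.pair_sym_arcs
    by unfold_locales
      (auto simp: disjoint_union_def symmetric_def sym_def
        dest: G.in_arcsD1 G.in_arcsD2 H.in_arcsD1 H.in_arcsD2 G.pair_no_loops H.pair_no_loops)
qed

lemma pair_graph_graph_join:
  assumes "pair_graph G" "pair_graph H"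
  shows "pair_graph (graph_join G H)"
proof -
  interpret G: pair_graph G by fact
  interpret H: pair_graph H by fact
  interpret U: pair_graph "disjoint_union G H" by (rule pair_graph_disjoint_union) fact+
  have "pverts (disjoint_union G H) = pverts G <+> pverts H" by (simp add: disjoint_union_def)
  then show ?thesis
    using U.pair_sym_arcs U.arc_fst_in_verts U.arc_snd_in_verts U.pair_no_loops
    by unfold_locales (auto simp: graph_join_def symmetric_def sym_def)
qed

lemma pair_graph_extremal_graph: "pair_graph (extremal_graph t n)"
  unfolding extremal_graph_def
  by (intro pair_graph_graph_join pair_graph_disjoint_union pair_graph_complete_graph)

lemma card_verts_extremal_graph:
  assumes "t \<ge> 1" "n \<ge> 2 * t"
  shows "card (pverts (extremal_graph t n)) = n"
  using assms
  by (simp add: extremal_graph_def graph_join_def disjoint_union_def complete_graph_def card_Plus)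

lemma bij_betw_vertex_enum:
  assumes "finite (verts G)"
  shows "bij_betw (vertex_enum G) {0..<card (verts G)} (verts G)"
  unfolding vertex_enum_def using ex_bij_betw_nat_finite[OF assms] by (rule someI_ex)

lemma eigenvalue_adjacency_matrix_iff:
  assumes fin: "finite (verts G)"
  shows "eigenvalue (adjacency_matrix G) k \<longleftrightarrow>
    (\<exists>x. (\<exists>v \<in> verts G. x v \<noteq> 0) \<and>
         (\<forall>v \<in> verts G. (\<Sum>u \<in> {u \<in> verts G. v \<rightarrow>\<^bsub>G\<^esub> u}. x u) = k * x v))"
proof -
  define n where "n = card (verts G)"
  define e where "e = vertex_enum G"
  have bij: "bij_betw e {0..<n} (verts G)"
    unfolding e_def n_def by (rule bij_betw_vertex_enum[OF fin])
  have mem: "e i \<in> verts G" if "i < n" for i using bij_betwE[OF bij] that by simp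
  have surj: "\<exists>i<n. v = e i" if "v \<in> verts G" for v
    using bij_betw_imp_surj_on[OF bij] that by force
  have ball_enum: "(\<forall>v \<in> verts G. P v) \<longleftrightarrow> (\<forall>i<n. P (e i))" for P
    using mem surj by blast
  have dim: "dim_row (adjacency_matrix G) = n" "dim_col (adjacency_matrix G) = n"
    by (simp_all add: adjacency_matrix_def n_def)
  have row_sum: "(adjacency_matrix G *\<^sub>v vec n (\<lambda>j. x (e j))) $ i =
      (\<Sum>u \<in> {u \<in> verts G. e i \<rightarrow>\<^bsub>G\<^esub> u}. x u)" if "i < n" for i and x :: "'a \<Rightarrow> real"
  proof -
    have "(adjacency_matrix G *\<^sub>v vec n (\<lambda>j. x (e j))) $ i =
        (\<Sum>j \<in> {0..<n}. if e i \<rightarrow>\<^bsub>G\<^esub> e j then x (e j) else 0)"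
      using that by (auto simp: adjacency_matrix_def n_def[symmetric] e_def[symmetric]
          scalar_prod_def intro!: sum.cong)
    also have "\<dots> = (\<Sum>u \<in> verts G. if e i \<rightarrow>\<^bsub>G\<^esub> u then x u else 0)"
      by (rule sum.reindex_bij_betw[OF bij])
    also have "\<dots> = (\<Sum>u \<in> {u \<in> verts G. e i \<rightarrow>\<^bsub>G\<^esub> u}. x u)"
      using fin by (simp add: sum.inter_filter)
    finally show ?thesis .
  qed
  have eigen: "eigenvector (adjacency_matrix G) (vec n (\<lambda>j. x (e j))) k \<longleftrightarrow>
      (\<exists>v \<in> verts G. x v \<noteq> 0) \<and>
      (\<forall>v \<in> verts G. (\<Sum>u \<in> {u \<in> verts G. v \<rightarrow>\<^bsub>G\<^esub> u}. x u) = k * x v)" for x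
  proof -
    have "vec n (\<lambda>j. x (e j)) \<noteq> 0\<^sub>v n \<longleftrightarrow> (\<exists>v \<in> verts G. x v \<noteq> 0)"
      using mem surj by (auto simp: vec_eq_iff)
    moreover have "adjacency_matrix G *\<^sub>v vec n (\<lambda>j. x (e j)) = k \<cdot>\<^sub>v vec n (\<lambda>j. x (e j)) \<longleftrightarrow>
        (\<forall>i<n. (\<Sum>u \<in> {u \<in> verts G. e i \<rightarrow>\<^bsub>G\<^esub> u}. x u) = k * x (e i))"
      using row_sum[of _ x] by (subst vec_eq_iff) (simp add: dim del: index_mult_mat_vec)
    moreover have "\<dots> \<longleftrightarrow>
        (\<forall>v \<in> verts G. (\<Sum>u \<in> {u \<in> verts G. v \<rightarrow>\<^bsub>G\<^esub> u}. x u) = k * x v)"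
      by (rule ball_enum[symmetric])
    ultimately show ?thesis by (simp add: eigenvector_def dim)
  qed
  show ?thesis
  proof
    assume "eigenvalue (adjacency_matrix G) k"
    then obtain w where w: "eigenvector (adjacency_matrix G) w k" by (auto simp: eigenvalue_def)
    define x where "x v = w $ (the_inv_into {0..<n} e v)" for v
    have "x (e j) = w $ j" if "j < n" for j
      using that bij by (simp add: x_def the_inv_into_f_f bij_betw_def)
    then have w_eq: "w = vec n (\<lambda>j. x (e j))"
      using w by (auto simp: eigenvector_def dim vec_eq_iff)
    show "\<exists>x. (\<exists>v \<in> verts G. x v \<noteq> 0) \<and>
        (\<forall>v \<in> verts G. (\<Sum>u \<in> {u \<in> verts G. v \<rightarrow>\<^bsub>G\<^esub> u}. x u) = k * x v)"
      by (intro exI[of _ x] iffD1[OF eigen]) (rule w[unfolded w_eq])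
  next
    assume "\<exists>x. (\<exists>v \<in> verts G. x v \<noteq> 0) \<and>
        (\<forall>v \<in> verts G. (\<Sum>u \<in> {u \<in> verts G. v \<rightarrow>\<^bsub>G\<^esub> u}. x u) = k * x v)"
    then show "eigenvalue (adjacency_matrix G) k" using eigen by (auto simp: eigenvalue_def)
  qed
qed

lemma finite_spectrum_adjacency_matrix: "finite (spectrum (adjacency_matrix G))"
  by (rule card_finite_spectrum(1)[where n = "card (verts G)"]) (simp add: adjacency_matrix_def)

lemma spectrum_adjacency_matrix_nonempty:
  assumes "graph G" and nonempty: "verts G \<noteq> {}"
  shows "spectrum (adjacency_matrix G) \<noteq> {}"
proof -
  interpret graph G by fact
  define n where "n = card (verts G)"
  define A where "A = map_mat complex_of_real (adjacency_matrix G)"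
  have A: "A \<in> carrier_mat n n" by (simp add: A_def adjacency_matrix_def n_def)
  have A_real: "A $$ (i, j) \<in> \<real>" if "i < n" "j < n" for i j
    using that by (simp add: A_def adjacency_matrix_def n_def)
  have A_sym: "A $$ (i, j) = A $$ (j, i)" if "i < n" "j < n" for i j
    using that arcs_ends_symmetric[OF sym_arcs]
    by (auto simp: A_def adjacency_matrix_def n_def)
  have "n > 0" using nonempty by (simp add: n_def card_gt_0_iff)
  from spectrum_non_empty[OF A this] obtain k where "eigenvalue A k"
    by (auto simp: spectrum_def)
  then obtain z where z: "z \<in> carrier_vec n" "z \<noteq> 0\<^sub>v n" "A *\<^sub>v z = k \<cdot>\<^sub>v z"
    using A by (auto simp: eigenvalue_def eigenvector_def)
  have row: "(\<Sum>j<n. A $$ (i, j) * z $ j) = k * z $ i" if "i < n" for i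
    using arg_cong[OF z(3), of "\<lambda>v. v $ i"] that A z(1)
    by (simp add: scalar_prod_def atLeast0LessThan)
  define q where "q = (\<Sum>i<n. \<Sum>j<n. cnj (z $ i) * A $$ (i, j) * z $ j)"
  define s where "s = (\<Sum>i<n. (cmod (z $ i))\<^sup>2)"
  have "q = (\<Sum>i<n. cnj (z $ i) * (k * z $ i))"
    unfolding q_def by (intro sum.cong refl) (simp add: row[symmetric] sum_distrib_left mult.assoc)
  also have "\<dots> = k * complex_of_real s"
    unfolding s_def by (simp add: sum_distrib_left complex_norm_square mult_ac del: of_real_power)
  finally have qs: "q = k * complex_of_real s" .
  have "cnj q = (\<Sum>i<n. \<Sum>j<n. z $ i * A $$ (i, j) * cnj (z $ j))"
    unfolding q_def using A_real by (simp add: Reals_cnj_iff)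
  also have "\<dots> = (\<Sum>j<n. \<Sum>i<n. z $ i * A $$ (i, j) * cnj (z $ j))" by (rule sum.swap)
  also have "\<dots> = q" unfolding q_def
  proof (intro sum.cong refl)
    fix i j assume "i \<in> {..<n}" "j \<in> {..<n}"
    then show "z $ j * A $$ (j, i) * cnj (z $ i) = cnj (z $ i) * A $$ (i, j) * z $ j"
      using A_sym[of i j] by simp
  qed
  finally have "cnj q = q" .
  obtain i where i: "i < n" "z $ i \<noteq> 0" using z(1,2) by (auto simp: vec_eq_iff)
  have "s > 0" unfolding s_def by (rule sum_pos2[of _ i]) (use i in auto)
  with qs \<open>cnj q = q\<close> have "cnj k = k" by simp
  then have k: "k = complex_of_real (Re k)" by (simp add: complex_eq_iff)
  have "poly (char_poly A) k = 0"
    using \<open>eigenvalue A k\<close> by (simp add: eigenvalue_root_char_poly[OF A])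
  then have "poly (map_poly complex_of_real (char_poly (adjacency_matrix G))) (complex_of_real (Re k)) = 0"
    using k by (simp add: A_def of_real_hom.char_poly_hom[where n = n] adjacency_matrix_def n_def)
  then have "poly (char_poly (adjacency_matrix G)) (Re k) = 0"
    by simp
  then have "eigenvalue (adjacency_matrix G) (Re k)"
    by (subst eigenvalue_root_char_poly[where n = n]) (auto simp: adjacency_matrix_def n_def)
  then show ?thesis by (auto simp: spectrum_def)
qed

end

theory Submission
  imports Defs "HOL-Analysis.Convex"
begin

text \<open>
  Put \<open>H = K\<^sub>2\<^sub>t\<^sub>-\<^sub>1 \<nabla> (K\<^sub>n\<^sub>-\<^sub>2\<^sub>t \<union> K\<^sub>1)\<close>. An explicit positive eigenvector shows
  \<open>\<rho>(H) \<ge> n - 2\<close>. Hong's inequality \<open>\<rho>(G)\<^sup>2 \<le> 2 e(G) - n + 1\<close> then leaves at most \<open>2 n - 3\<close> ordered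
  pairs of distinct nonadjacent vertices in \<open>G\<close>. If \<open>G\<close> is not \<open>t\<close>-tough, some \<open>S\<close> with
  \<open>|S| \<le> t c - 1\<close> leaves \<open>c \<ge> 2\<close> components, and the pairs in different components already exceed this
  number unless \<open>c = 2\<close> and one of the two components is a single vertex. In that case \<open>G\<close> is a
  spanning subgraph of \<open>H\<close>, and by strict monotonicity of the spectral radius \<open>G \<cong> H\<close>.
\<close>

section \<open>Bounds on eigenvalues\<close>

text \<open>Hong's inequality, with the degree sum for twice the number of edges. Cauchy-Schwarz at
  each vertex, summed over \<open>V\<close>, weights \<open>(x u)\<^sup>2\<close> by the degree sum
  over the neighbours of \<open>u\<close>. Outside that neighbourhood, \<open>u\<close> itself has
  degree \<open>d u\<close> and each of the \<open>card V - 1 - d u\<close> other vertices has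
  degree at least 1, so \<open>d u\<close> cancels in the bound.\<close>

lemma eigenvalue_square_le_edges:
  fixes x :: "'a \<Rightarrow> real"
  assumes fin: "finite V"
    and sym: "\<And>u v. u \<in> V \<Longrightarrow> v \<in> V \<Longrightarrow> E u v \<Longrightarrow> E v u"
    and irrefl: "\<And>v. v \<in> V \<Longrightarrow> \<not> E v v"
    and deg: "\<And>v. v \<in> V \<Longrightarrow> \<exists>u \<in> V. E v u"
    and nz: "\<exists>v \<in> V. x v \<noteq> 0"
    and eig: "\<And>v. v \<in> V \<Longrightarrow> (\<Sum>u \<in> {u \<in> V. E v u}. x u) = k * x v"
  shows "k\<^sup>2 \<le> (\<Sum>v \<in> V. real (card {u \<in> V. E v u})) - (real (card V) - 1)"
proof -
  define d where "d v = real (card {u \<in> V. E v u})" for v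
  define D where "D = (\<Sum>v \<in> V. d v)"
  have d_ge1: "1 \<le> d v" if "v \<in> V" for v
    using deg[OF that] fin by (auto simp: d_def Suc_le_eq card_gt_0_iff)
  have nbr: "(\<Sum>v \<in> {v \<in> V. E u v}. d v) \<le> D - (real (card V) - 1)" if u: "u \<in> V" for u
  proof -
    define N where "N = {v \<in> V. E u v}"
    have N: "finite N" "N \<subseteq> V - {u}" using fin irrefl[OF u] by (auto simp: N_def)
    have "D = d u + (\<Sum>v \<in> V - {u}. d v)"
      unfolding D_def using fin u by (rule sum.remove)
    also have "(\<Sum>v \<in> V - {u}. d v) = (\<Sum>v \<in> V - {u} - N. d v) + (\<Sum>v \<in> N. d v)"
      using fin N by (intro sum.subset_diff) auto
    finally have D: "D = d u + (\<Sum>v \<in> V - {u} - N. d v) + (\<Sum>v \<in> N. d v)" by simp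
    have "real (card (V - {u} - N)) \<le> (\<Sum>v \<in> V - {u} - N. d v)"
      using sum_mono[of "V - {u} - N" "\<lambda>_. 1" d] d_ge1 by auto
    moreover have "real (card (V - {u} - N)) = real (card V) - 1 - d u"
    proof -
      have "card (V - {u} - N) = card (V - {u}) - card N"
        using N fin by (intro card_Diff_subset) auto
      moreover have "card N \<le> card (V - {u})" using N fin by (intro card_mono) auto
      moreover have "card (V - {u}) = card V - 1" "card V \<ge> 1"
        using fin u by (auto simp: Suc_le_eq card_gt_0_iff)
      ultimately show ?thesis by (simp add: d_def N_def of_nat_diff)
    qed
    ultimately show ?thesis using D by (simp add: N_def)
  qed
  define X where "X = (\<Sum>v \<in> V. (x v)\<^sup>2)"
  from nz obtain v where "v \<in> V" "x v \<noteq> 0" by blast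
  then have "X > 0" unfolding X_def using fin by (intro sum_pos2[of _ v]) auto
  have "k\<^sup>2 * X = (\<Sum>v \<in> V. (\<Sum>u \<in> {u \<in> V. E v u}. x u)\<^sup>2)"
    by (simp add: X_def eig power_mult_distrib sum_distrib_left)
  also have "\<dots> \<le> (\<Sum>v \<in> V. (\<Sum>u \<in> {u \<in> V. E v u}. (x u)\<^sup>2) * d v)"
    unfolding d_def by (intro sum_mono sum_squared_le_sum_of_squares)
  also have "\<dots> = (\<Sum>v \<in> V. \<Sum>u \<in> {u \<in> V. E v u}. (x u)\<^sup>2 * d v)"
    by (simp add: sum_distrib_right)
  also have "\<dots> = (\<Sum>u \<in> V. \<Sum>v \<in> {v \<in> V. E v u}. (x u)\<^sup>2 * d v)"
    by (rule sum.swap_restrict[OF fin fin])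
  also have "\<dots> = (\<Sum>u \<in> V. (x u)\<^sup>2 * (\<Sum>v \<in> {v \<in> V. E u v}. d v))"
    unfolding sum_distrib_left by (intro sum.cong refl) (auto intro: sym)
  also have "\<dots> \<le> (\<Sum>u \<in> V. (x u)\<^sup>2 * (D - (real (card V) - 1)))"
    by (intro sum_mono mult_left_mono nbr) auto
  also have "\<dots> = (D - (real (card V) - 1)) * X"
    by (simp add: X_def sum_distrib_left mult.commute)
  finally show ?thesis using \<open>X > 0\<close> by (simp add: D_def d_def)
qed

text \<open>
  Pairing \<open>\<bar>x\<bar>\<close> with the positive eigenvector \<open>y\<close> of the larger graph forces equality in
  \<open>l \<bar>x\<bar> \<le> A\<^sub>E \<bar>x\<bar> \<le> A\<^sub>H \<bar>x\<bar>\<close>, and \<open>\<bar>x\<bar>\<close> is positive because \<open>E\<close> is connected.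
\<close>
lemma spanning_subgraph_eigenvalue_ge_imp_eq:
  fixes x y :: "'a \<Rightarrow> real"
  assumes fin: "finite V"
    and sub: "\<And>u v. u \<in> V \<Longrightarrow> v \<in> V \<Longrightarrow> E u v \<Longrightarrow> H u v"
    and H_sym: "\<And>u v. u \<in> V \<Longrightarrow> v \<in> V \<Longrightarrow> H u v \<Longrightarrow> H v u"
    and conn: "\<And>Z u v. u \<in> Z \<Longrightarrow> u \<in> V \<Longrightarrow> v \<in> V \<Longrightarrow>
      (\<And>a b. a \<in> Z \<Longrightarrow> a \<in> V \<Longrightarrow> b \<in> V \<Longrightarrow> E a b \<Longrightarrow> b \<in> Z) \<Longrightarrow> v \<in> Z"
    and x_nz: "\<exists>v \<in> V. x v \<noteq> 0"
    and x_eig: "\<And>v. v \<in> V \<Longrightarrow> (\<Sum>u \<in> {u \<in> V. E v u}. x u) = k * x v"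
    and y_pos: "\<And>v. v \<in> V \<Longrightarrow> y v > 0"
    and y_eig: "\<And>v. v \<in> V \<Longrightarrow> (\<Sum>u \<in> {u \<in> V. H v u}. y u) = l * y v"
    and kl: "l \<le> k"
    and uv: "u \<in> V" "v \<in> V" "H u v"
  shows "E u v"
proof -
  define z where "z v = \<bar>x v\<bar>" for v
  define e where "e v = (\<Sum>u \<in> {u \<in> V. E v u}. z u)" for v
  define h where "h v = (\<Sum>u \<in> {u \<in> V. H v u}. z u)" for v
  have z_nonneg: "0 \<le> z v" for v by (simp add: z_def)
  have le1: "l * z v \<le> e v" if "v \<in> V" for v
  proof -
    have "l * z v \<le> k * z v" using kl z_nonneg by (intro mult_right_mono)
    also have "\<dots> \<le> \<bar>k * x v\<bar>" by (simp add: z_def abs_mult mult_right_mono)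
    also have "\<dots> = \<bar>\<Sum>u \<in> {u \<in> V. E v u}. x u\<bar>" using x_eig[OF that] by simp
    also have "\<dots> \<le> e v" unfolding e_def z_def by (rule sum_abs)
    finally show ?thesis .
  qed
  have split: "h v = e v + (\<Sum>u \<in> {u \<in> V. H v u \<and> \<not> E v u}. z u)" if "v \<in> V" for v
  proof -
    have "{u \<in> V. H v u} = {u \<in> V. E v u} \<union> {u \<in> V. H v u \<and> \<not> E v u}"
      using sub[OF that] by auto
    then show ?thesis unfolding h_def e_def using fin by (simp add: sum.union_disjoint disjoint_iff)
  qed
  have le2: "e v \<le> h v" if "v \<in> V" for v
    unfolding split[OF that] by (simp add: sum_nonneg z_nonneg)
  \<comment> \<open>By symmetry of \<open>H\<close> the adjacency operator moves from
    \<open>z\<close> onto its eigenvector \<open>y\<close>. Hence the defects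
    \<open>h v - l * z v\<close>, which are nonnegative, have weighted sum 0 with positive
    weights.\<close>
  have "(\<Sum>v \<in> V. y v * h v) = (\<Sum>v \<in> V. \<Sum>u \<in> {u \<in> V. H v u}. y v * z u)"
    by (simp add: h_def sum_distrib_left)
  also have "\<dots> = (\<Sum>u \<in> V. \<Sum>v \<in> {v \<in> V. H v u}. y v * z u)"
    by (rule sum.swap_restrict[OF fin fin])
  also have "\<dots> = (\<Sum>u \<in> V. (\<Sum>v \<in> {v \<in> V. H u v}. y v) * z u)"
    unfolding sum_distrib_right by (intro sum.cong refl) (auto intro: H_sym)
  also have "\<dots> = (\<Sum>u \<in> V. y u * (l * z u))"
    by (intro sum.cong refl) (simp add: y_eig)
  finally have "(\<Sum>v \<in> V. y v * (h v - l * z v)) = 0"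
    by (simp add: right_diff_distrib sum_subtractf)
  moreover have nonneg: "0 \<le> y v * (h v - l * z v)" if "v \<in> V" for v
    using le1[OF that] le2[OF that] y_pos[OF that] by simp
  ultimately have "y v * (h v - l * z v) = 0" if "v \<in> V" for v
    using that fin sum_nonneg_eq_0_iff[of V "\<lambda>v. y v * (h v - l * z v)"] by blast
  then have hz: "h v = l * z v" if "v \<in> V" for v
    using that y_pos[OF that] by force
  then have ez: "e v = l * z v" if "v \<in> V" for v
    using that le1[OF that] le2[OF that] by force
  have z_pos: "z v \<noteq> 0" if "v \<in> V" for v
  proof
    assume "z v = 0"
    \<comment> \<open>A zero of \<open>z\<close> spreads along \<open>E\<close>:
      \<open>e a = l * z a = 0\<close> is a sum of nonnegative terms. By \<open>conn\<close> it
      would reach all of \<open>V\<close>.\<close>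
    have step: "z b = 0" if "a \<in> V" "b \<in> V" "E a b" "z a = 0" for a b
    proof -
      have "e a = 0" using ez that by simp
      then show ?thesis using that fin z_nonneg
        by (auto simp: e_def sum_nonneg_eq_0_iff)
    qed
    have "w \<in> {u. z u = 0}" if "w \<in> V" for w
      by (rule conn[of v]) (use \<open>z v = 0\<close> \<open>v \<in> V\<close> that step in auto)
    then show False using x_nz by (auto simp: z_def)
  qed
  have "(\<Sum>w \<in> {w \<in> V. H u w \<and> \<not> E u w}. z w) = 0"
    using split[OF uv(1)] hz[OF uv(1)] ez[OF uv(1)] by simp
  then have "\<forall>w \<in> {w \<in> V. H u w \<and> \<not> E u w}. z w = 0"
    using fin z_nonneg by (subst (asm) sum_nonneg_eq_0_iff) auto
  then show ?thesis using uv z_pos by blast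
qed

section \<open>The extremal graph\<close>

text \<open>
  The equation says that \<open>l\<close> is an eigenvalue of the quotient matrix of the equitable partition of
  \<open>K\<^sub>a \<nabla> (K\<^sub>b \<union> K\<^sub>1)\<close>, with eigenvector \<open>(1, a / (l - b + 1), a / l)\<close>.
\<close>
lemma quotient_eigenvalue_exists:
  fixes a b :: real
  assumes "a \<ge> 1" "b \<ge> 1"
  shows "\<exists>l \<ge> a + b - 1. l = a - 1 + b * (a / (l - b + 1)) + a / l"
proof -
  define f where "f l = l - (a - 1) - b * (a / (l - b + 1)) - a / l" for l
  \<comment> \<open>Here \<open>l - b + 1\<close> equals \<open>a\<close>, so the value is
    \<open>- a / (a + b - 1)\<close>. For the extremal graph this left endpoint is
    \<open>n - 2\<close>.\<close>
  have "f (a + b - 1) \<le> 0" using assms by (simp add: f_def)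
  moreover have "f (a + b) \<ge> 0"
  proof -
    have "b * (a / (a + 1)) \<le> b * 1" using assms by (intro mult_left_mono) auto
    moreover have "a / (a + b) \<le> 1" using assms by simp
    ultimately show ?thesis by (simp add: f_def)
  qed
  moreover have "continuous_on {a + b - 1..a + b} f"
    unfolding f_def using assms by (intro continuous_intros) auto
  ultimately obtain l where "a + b - 1 \<le> l" "f l = 0"
    using IVT'[of f "a + b - 1" 0 "a + b"] by auto
  then show ?thesis by (intro exI[of _ l]) (auto simp: f_def)
qed

text \<open>Adjacency of the join of a clique \<open>S\<close> with the union of another clique and
  the single vertex \<open>v\<close>. No vertex set is fixed, so the same relation describes the
  extremal graph and a supergraph of \<open>G\<close> on the vertices of \<open>G\<close>.\<close>

definition pendant_adj :: "'a \<Rightarrow> 'a set \<Rightarrow> 'a \<Rightarrow> 'a \<Rightarrow> bool" where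
  "pendant_adj v S u w \<longleftrightarrow> u \<noteq> w \<and> (u = v \<longrightarrow> w \<in> S) \<and> (w = v \<longrightarrow> u \<in> S)"

text \<open>\<open>y\<close> is constant on \<open>S\<close>, on \<open>{v}\<close> and on the rest.
  The rows of \<open>v\<close> and of the rest hold by the choice of the values \<open>a / l\<close>
  and \<open>a / (l - b + 1)\<close>; the row of \<open>S\<close> is the equation assumed for
  \<open>l\<close>.\<close>

lemma pendant_adj_eigenvector:
  fixes l :: real
  assumes fin: "finite V" and v: "v \<in> V" "v \<notin> S" and S: "S \<subseteq> V"
    and a: "real (card S) = a" and b: "real (card V) = a + b + 1"
    and "a \<ge> 1" "b \<ge> 1" "l \<ge> a + b - 1"
    and l: "l = a - 1 + b * (a / (l - b + 1)) + a / l"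
    and y: "y = (\<lambda>u. if u = v then a / l else if u \<in> S then 1 else a / (l - b + 1))"
    and w: "w \<in> V"
  shows "y w > 0" "(\<Sum>u \<in> {u \<in> V. pendant_adj v S w u}. y u) = l * y w"
proof -
  show "y w > 0" using assms by auto
  define R where "R = V - S - {v}"
  define r where "r = a / (l - b + 1)"
  have fin': "finite S" "finite R" using fin S by (auto simp: R_def intro: finite_subset)
  have VR: "V = insert v (S \<union> R)" "S \<inter> R = {}" "v \<notin> S" "v \<notin> R"
    using v S by (auto simp: R_def)
  have cR: "real (card R) = b"
    using b a fin' VR(2-4) by (simp add: VR(1) card_Un_disjoint)
  have pos: "l > 0" "l - b + 1 > 0" using assms by auto
  have sumS: "sum y S = a" 
  proof -
    have "sum y S = (\<Sum>u \<in> S. 1)" using VR by (intro sum.cong) (auto simp: y)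
    then show ?thesis using a by simp
  qed
  have sumR: "sum y R = b * r"
  proof -
    have "sum y R = (\<Sum>u \<in> R. r)" using VR by (intro sum.cong) (auto simp: y r_def)
    then show ?thesis using cR by simp
  qed
  consider "w = v" | "w \<in> S" | "w \<in> R" using w VR(1) by auto
  then show "(\<Sum>u \<in> {u \<in> V. pendant_adj v S w u}. y u) = l * y w"
  proof cases
    case 1
    then have "{u \<in> V. pendant_adj v S w u} = S" using v S by (auto simp: pendant_adj_def)
    then show ?thesis using 1 sumS pos by (simp add: y)
  next
    case 2
    then have "{u \<in> V. pendant_adj v S w u} = insert v ((S - {w}) \<union> R)"
      using v VR by (auto simp: pendant_adj_def)
    moreover have "sum y \<dots> = y v + (sum y (S - {w}) + sum y R)"
      using fin' VR by (subst sum.insert) (auto intro!: sum.union_disjoint)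
    moreover have "sum y (S - {w}) = a - 1"
      using 2 sumS fin' VR by (subst sum_diff1) (auto simp: y)
    moreover have "y v = a / l" "y w = 1" using 2 VR by (auto simp: y)
    ultimately show ?thesis using sumR l by (simp add: r_def)
  next
    case 3
    then have "{u \<in> V. pendant_adj v S w u} = S \<union> (R - {w})"
      using v VR by (auto simp: pendant_adj_def)
    moreover have "sum y \<dots> = sum y S + sum y (R - {w})"
      using fin' VR by (intro sum.union_disjoint) auto
    moreover have "y w = r" using 3 VR by (auto simp: y r_def)
    moreover have "sum y (R - {w}) = b * r - y w"
      using 3 sumR fin' by (subst sum_diff1) auto
    moreover have "(l - b + 1) * r = a" using pos by (simp add: r_def)
    ultimately show ?thesis using sumS by (simp add: algebra_simps)
  qed
qed

lemma parcs_extremal_graph: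
  assumes "u \<in> pverts (extremal_graph t n)" "w \<in> pverts (extremal_graph t n)"
  shows "(u, w) \<in> parcs (extremal_graph t n) \<longleftrightarrow>
    pendant_adj (Inr (Inr 0)) (Inl ` {0..<2 * t - 1}) u w"
proof -
  have image: "map_prod f g ` {(i, j). P i j} = {(f i, g j) | i j. P i j}"
    for f :: "'c \<Rightarrow> 'd" and g :: "'e \<Rightarrow> 'f" and P
    by auto
  show ?thesis
    using assms
    by (auto simp: extremal_graph_def graph_join_def disjoint_union_def complete_graph_def
        pendant_adj_def image_Un image)
qed

section \<open>Components and nonadjacent pairs\<close>

text \<open>This makes strongly connected components available for counting. A connected subgraph
  may contain only one arc of an opposite pair and fail to be strongly connected, but the subgraph
  induced on its vertices is symmetric and hence strongly connected; maximal subgraphs coincide with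
  it.\<close>

lemma (in sym_digraph) max_subgraph_connected_iff:
  "max_subgraph Digraph_Component.connected H \<longleftrightarrow> max_subgraph strongly_connected H"
proof
  have induce_sc: "strongly_connected (G \<restriction> verts H)"
    if H: "subgraph H G" "Digraph_Component.connected H" for H
  proof -
    have vs: "verts H \<subseteq> verts G" using H by auto
    interpret I: wf_digraph "G \<restriction> verts H" by (rule wellformed_induce_subgraph)
    have "symmetric (G \<restriction> verts H)"
      using sym_arcs unfolding symmetric_conv by (auto simp: symmetric_conv) metis
    moreover have "spanning H (G \<restriction> verts H)"
      using H by (auto simp: spanning_def subgraph_induce_subgraphI2)
    ultimately show ?thesis
      using H by (intro I.symmetric_connected_imp_strongly_connected
          I.connected_spanning_imp_connected[of H])
  qed
  have ind: "subgraph (G \<restriction> verts H) G" if "subgraph H G" for H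
    using that by (intro subgraph_induce_subgraphI) auto
  have conn: "Digraph_Component.connected H" if "subgraph H G" "strongly_connected H" for H
  proof -
    interpret H: wf_digraph H using that by auto
    show ?thesis
      using that(2) H.reachable_mk_symmetricI
      by (auto simp: connected_def strongly_connected_def)
  qed
  {
    assume H: "max_subgraph Digraph_Component.connected H"
    then have sub: "subgraph H G" and c: "Digraph_Component.connected H"
      by (auto simp: max_subgraph_def)
    have "H = G \<restriction> verts H"
      using H conn[OF ind[OF sub] induce_sc[OF sub c]] ind[OF sub] subgraph_induce_subgraphI2[OF sub]
      by (metis max_subgraph_def)
    then have "strongly_connected H" using induce_sc[OF sub c] by simp
    then show "max_subgraph strongly_connected H"
      using H conn unfolding max_subgraph_def by blast
  next
    assume H: "max_subgraph strongly_connected H"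
    then have sub: "subgraph H G" and c: "strongly_connected H"
      by (auto simp: max_subgraph_def)
    show "max_subgraph Digraph_Component.connected H"
    proof (rule max_subgraphI)
      fix K assume K: "H \<noteq> K" "subgraph H K" "subgraph K G"
      show "\<not> Digraph_Component.connected K"
      proof
        assume "Digraph_Component.connected K"
        then have "strongly_connected (G \<restriction> verts K)" using K induce_sc by blast
        moreover have 1: "subgraph K (G \<restriction> verts K)"
          using K(3) by (rule subgraph_induce_subgraphI2)
        moreover have 2: "subgraph H (G \<restriction> verts K)" using K(2) 1 by (rule subgraph_trans)
        ultimately have "G \<restriction> verts K = H" using H ind[OF K(3)] by (auto simp: max_subgraph_def)
        then have "subgraph K H" using 1 by simp
        with K(1,2) show False by (auto simp: subgraph_def compatible_def)
      qed
    qed (use sub c conn in auto)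
  }
qed

lemma (in sym_digraph) num_components_eq_card_scc_of:
  "num_components G = card (scc_of ` verts G)"
  unfolding num_components_def max_subgraph_connected_iff sccs_altdef2[symmetric]
  by (simp add: card_sccs_verts[symmetric] sccs_verts_conv_scc_of)

lemma (in sym_digraph) scc_of_eq_of_adj:
  assumes "u \<rightarrow>\<^bsub>G\<^esub> v"
  shows "scc_of u = scc_of v"
proof -
  have "u \<rightarrow>\<^sup>* v" "v \<rightarrow>\<^sup>* u"
    using assms arcs_ends_symmetric[OF sym_arcs] by auto
  then show ?thesis unfolding scc_of_def by (auto intro: reachable_trans)
qed

text \<open>Replaces components by a vertex labelling, so that the later counting deals only with
  label classes.\<close>

lemma (in graph) component_classes:
  obtains f :: "'a \<Rightarrow> 'a set" where "card (f ` W) = num_components (G \<restriction> W)"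
    and "\<And>u w. u \<in> W \<Longrightarrow> w \<in> W \<Longrightarrow> u \<rightarrow>\<^bsub>G\<^esub> w \<Longrightarrow> f u = f w"
proof
  have "symmetric (G \<restriction> W)"
    using sym_arcs unfolding symmetric_conv by auto metis
  then interpret I: sym_digraph "G \<restriction> W"
    using wellformed_induce_subgraph by (simp add: sym_digraph_def sym_digraph_axioms_def)
  show "card (I.scc_of ` W) = num_components (G \<restriction> W)"
    by (simp add: I.num_components_eq_card_scc_of)
  show "I.scc_of u = I.scc_of w" if "u \<in> W" "w \<in> W" "u \<rightarrow>\<^bsub>G\<^esub> w" for u w
    using that by (intro I.scc_of_eq_of_adj) (auto simp: arcs_ends_conv)
qed

text \<open>For \<open>v\<close> in \<open>W\<close>, its neighbours, the vertices of
  \<open>W\<close> with another label and \<open>v\<close> itself are disjoint. Summing over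
  \<open>V\<close> counts the differently labelled ordered pairs, of which there are
  \<open>card W * card W\<close> minus the squares of the class sizes. The additive form avoids
  subtraction on naturals.\<close>

lemma sum_degrees_le:
  assumes fin: "finite V" and W: "W \<subseteq> V"
    and irrefl: "\<And>v. v \<in> V \<Longrightarrow> \<not> E v v"
    and f: "\<And>u w. u \<in> W \<Longrightarrow> w \<in> W \<Longrightarrow> E u w \<Longrightarrow> f u = f w"
  shows "(\<Sum>v \<in> V. card {u \<in> V. E v u}) + card V + card W * card W
    \<le> card V * card V + (\<Sum>b \<in> f ` W. (card {w \<in> W. f w = b})\<^sup>2)"
proof -
  have finW: "finite W" using fin W by (rule rev_finite_subset)
  define g where "g v = (if v \<in> W then card {w \<in> W. f w \<noteq> f v} else 0)" for v
  have "card {u \<in> V. E v u} + g v + 1 \<le> card V" if v: "v \<in> V" for v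
  proof -
    define B where "B = (if v \<in> W then {w \<in> W. f w \<noteq> f v} else {})"
    have "card ({u \<in> V. E v u} \<union> B \<union> {v}) \<le> card V"
      using fin v W by (intro card_mono) (auto simp: B_def split: if_splits)
    also have "card ({u \<in> V. E v u} \<union> B \<union> {v}) = card ({u \<in> V. E v u} \<union> B) + 1"
      using fin finW irrefl[OF v] by (auto simp: B_def)
    also have "card ({u \<in> V. E v u} \<union> B) = card {u \<in> V. E v u} + card B"
      using fin finW f by (intro card_Un_disjoint) (auto simp: B_def split: if_splits)
    also have "card B = g v" by (simp add: B_def g_def)
    finally show ?thesis .
  qed
  then have "(\<Sum>v \<in> V. card {u \<in> V. E v u} + g v + 1) \<le> (\<Sum>v \<in> V. card V)"
    by (rule sum_mono)
  then have "(\<Sum>v \<in> V. card {u \<in> V. E v u}) + (\<Sum>v \<in> V. g v) + card V \<le> card V * card V"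
    by (simp add: sum.distrib sum_Suc)
  moreover have "(\<Sum>v \<in> V. g v) = (\<Sum>v \<in> W. card {w \<in> W. f w \<noteq> f v})"
    unfolding g_def using fin W by (simp add: sum.If_cases Int_absorb1)
  moreover have "(\<Sum>v \<in> W. card {w \<in> W. f w \<noteq> f v}) + (\<Sum>v \<in> W. card {w \<in> W. f w = f v})
      = card W * card W"
  proof -
    have "card {w \<in> W. f w \<noteq> f v} + card {w \<in> W. f w = f v} = card W" for v
      using finW by (subst card_Un_disjoint[symmetric]) (auto intro!: arg_cong[of _ _ card])
    then show ?thesis by (simp add: sum.distrib[symmetric])
  qed
  moreover have "(\<Sum>v \<in> W. card {w \<in> W. f w = f v}) = (\<Sum>b \<in> f ` W. (card {w \<in> W. f w = b})\<^sup>2)"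
  proof -
    have "(\<Sum>v \<in> W. card {w \<in> W. f w = f v}) =
        (\<Sum>b \<in> f ` W. \<Sum>v \<in> {v \<in> W. f v = b}. card {w \<in> W. f w = f v})"
      using finW by (rule sum.image_gen)
    also have "\<dots> = (\<Sum>b \<in> f ` W. \<Sum>v \<in> {v \<in> W. f v = b}. card {w \<in> W. f w = b})"
      by (intro sum.cong refl) auto
    also have "\<dots> = (\<Sum>b \<in> f ` W. (card {w \<in> W. f w = b})\<^sup>2)"
      by (simp add: power2_eq_square)
    finally show ?thesis .
  qed
  ultimately show ?thesis by linarith
qed

text \<open>For a fixed sum, the squares are largest when all parts but one equal 1. After
  subtracting 1 from each part this is the bound of a sum of squares of nonnegative numbers by the
  square of their sum.\<close>

lemma sum_squares_le_of_ge_one: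
  fixes p :: "'a \<Rightarrow> real"
  assumes "finite B" "\<And>b. b \<in> B \<Longrightarrow> p b \<ge> 1"
  shows "(\<Sum>b \<in> B. (p b)\<^sup>2) \<le> (sum p B - card B + 1)\<^sup>2 + card B - 1"
proof -
  define q where "q b = p b - 1" for b
  have q: "0 \<le> q b" if "b \<in> B" for b using assms that by (simp add: q_def)
  have "(\<Sum>b \<in> B. (q b)\<^sup>2) \<le> (\<Sum>b \<in> B. q b * sum q B)"
    unfolding power2_eq_square using q assms(1)
    by (intro sum_mono mult_left_mono member_le_sum) auto
  also have "\<dots> = (sum q B)\<^sup>2" by (simp add: sum_distrib_right power2_eq_square)
  finally have le: "(\<Sum>b \<in> B. (q b)\<^sup>2) \<le> (sum q B)\<^sup>2" .
  have "sum p B = sum q B + card B" by (simp add: q_def sum_subtractf)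
  moreover have "(\<Sum>b \<in> B. (p b)\<^sup>2) = (\<Sum>b \<in> B. (q b)\<^sup>2) + 2 * sum q B + card B"
    unfolding sum_distrib_left sum.distrib[symmetric] card_eq_sum of_nat_sum
    by (intro sum.cong refl) (simp add: q_def power2_eq_square algebra_simps)
  ultimately show ?thesis using le by (simp add: power2_eq_square algebra_simps)
qed

text \<open>
  \<open>c\<close> classes on \<open>m\<close> vertices leave at least \<open>(c - 1) (2 m - c)\<close> ordered nonadjacent pairs. For
  \<open>c \<le> 2 t + 2\<close> the hypothesis on \<open>n\<close> gives \<open>2 m - c \<ge> n + 2\<close>; larger \<open>c\<close> may be assumed to satisfy
  \<open>c (c - 1) \<le> 2 n - 3\<close>, since otherwise \<open>m \<ge> c\<close> suffices.
\<close>
lemma many_classes_bound: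
  fixes n m c t :: real
  assumes "t \<ge> 1" "n \<ge> (2 * t + 1) * (2 * t + 2)" "c \<ge> 3"
    and "c \<le> 2 * t + 2 \<or> c \<ge> 2 * t + 3" "m \<ge> c" "m \<ge> n - t * c + 1"
  shows "(c - 1) * (2 * m - c) > 2 * n - 3"
proof -
  have n_nonneg: "n \<ge> 0"
    using assms(1) by (intro order_trans[OF _ assms(2)]) simp
  show ?thesis
  proof (cases "c * (c - 1) \<le> 2 * n - 3")
    case False
    have "(c - 1) * c \<le> (c - 1) * (2 * m - c)" using assms by (intro mult_left_mono) auto
    with False show ?thesis by (simp add: mult.commute)
  next
    case c_le: True
    \<comment> \<open>The lower bound \<open>n - t * c + 1\<close> on \<open>m\<close>, inserted
      into \<open>2 * m - c\<close>.\<close>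
    have ge: "(c - 1) * (2 * (n + 1) - (2 * t + 1) * c) \<le> (c - 1) * (2 * m - c)"
      using assms by (intro mult_left_mono) (auto simp: algebra_simps)
    show ?thesis
    proof (cases "c \<le> 2 * t + 2")
      case True
      have "(2 * t + 1) * c \<le> (2 * t + 1) * (2 * t + 2)"
        using True assms by (intro mult_left_mono) auto
      then have "(2 * t + 1) * c \<le> n" using assms(2) by (rule order_trans)
      then have "n + 2 \<le> 2 * (n + 1) - (2 * t + 1) * c" by simp
      then have "2 * (n + 2) \<le> (c - 1) * (2 * (n + 1) - (2 * t + 1) * c)"
        using assms n_nonneg by (intro mult_mono) auto
      also note ge
      finally show ?thesis by simp
    next
      case False
      \<comment> \<open>Now \<open>c \<ge> 2 * t + 3\<close>; the disjunctive hypothesis expresses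
        integrality of \<open>c\<close> and \<open>t\<close>. Expanding the left side of
        \<open>ge\<close> and using both estimates leaves at least
        \<open>2 * n + 10 * t + 7\<close>.\<close>
      have "(2 * t + 1) * (c * (c - 1)) \<le> (2 * t + 1) * (2 * n - 3)"
        using c_le assms by (intro mult_left_mono) auto
      moreover have "(2 * t + 2) * (2 * (n + 1)) \<le> (c - 1) * (2 * (n + 1))"
        using False assms n_nonneg by (intro mult_right_mono) auto
      ultimately show ?thesis using ge assms by (simp add: algebra_simps)
    qed
  qed
qed

section \<open>Recognising the extremal graph up to isomorphism\<close>

lemma (in graph) digraph_iso_with_projI:
  assumes H: "pair_wf_digraph H" and bij: "bij_betw \<phi> (verts G) (pverts H)"
    and adj: "\<And>u w. u \<in> verts G \<Longrightarrow> w \<in> verts G \<Longrightarrow> u \<rightarrow>\<^bsub>G\<^esub> w \<longleftrightarrow> (\<phi> u, \<phi> w) \<in> parcs H"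
  shows "digraph_iso G (with_proj H)"
proof -
  interpret H: pair_wf_digraph H by fact
  \<comment> \<open>An arc of \<open>H\<close> is the pair of its ends, so \<open>\<phi>\<close>
    dictates the arc map; it is injective because \<open>G\<close> has no parallel arcs.\<close>
  define h where "h = \<lparr> iso_verts = \<phi>, iso_arcs = (\<lambda>e. (\<phi> (tail G e), \<phi> (head G e))),
    iso_head = snd, iso_tail = fst \<rparr>"
  have inj: "inj_on \<phi> (verts G)" and surj: "\<phi> ` verts G = pverts H"
    using bij by (auto simp: bij_betw_def)
  have "inj_on (iso_arcs h) (arcs G)"
  proof (rule inj_onI)
    fix e1 e2 assume e: "e1 \<in> arcs G" "e2 \<in> arcs G" "iso_arcs h e1 = iso_arcs h e2"
    then have "tail G e1 = tail G e2" "head G e1 = head G e2"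
      using inj by (auto simp: h_def dest: inj_onD)
    then show "e1 = e2" using e by (intro no_multi_arcs) (auto simp: arc_to_ends_def)
  qed
  then have "digraph_isomorphism h"
    using inj wf_digraph_axioms by (auto simp: digraph_isomorphism_def h_def)
  moreover have "iso_arcs h ` arcs G = parcs H"
  proof (intro equalityI subsetI)
    fix p assume "p \<in> iso_arcs h ` arcs G"
    then obtain e where e: "e \<in> arcs G" "p = (\<phi> (tail G e), \<phi> (head G e))" by (auto simp: h_def)
    then have "tail G e \<rightarrow>\<^bsub>G\<^esub> head G e" by (auto simp: arcs_ends_conv)
    then show "p \<in> parcs H" using e adj by auto
  next
    fix p assume p: "p \<in> parcs H"
    then have "fst p \<in> \<phi> ` verts G" "snd p \<in> \<phi> ` verts G"
      using surj H.arc_fst_in_verts H.arc_snd_in_verts by auto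
    then obtain u w where uw: "u \<in> verts G" "w \<in> verts G" "p = (\<phi> u, \<phi> w)"
      by (metis image_iff prod.collapse)
    then have "u \<rightarrow>\<^bsub>G\<^esub> w" using adj p by simp
    then obtain e where "e \<in> arcs G" "tail G e = u" "head G e = w" by blast
    then show "p \<in> iso_arcs h ` arcs G" using uw by (force simp: h_def)
  qed
  ultimately show ?thesis
    unfolding digraph_iso_def using surj
    by (intro exI[of _ h] conjI) (auto simp: with_proj_def app_iso_def h_def)
qed

text \<open>Adjacency depends only on which of the three parts contain the two vertices and on
  whether they are equal, so arbitrary bijections between corresponding parts combine to an
  isomorphism.\<close>

lemma (in graph) digraph_iso_extremal_graphI:
  assumes v: "v \<in> verts G" and S: "S \<subseteq> verts G" "v \<notin> S" "card S = 2 * t - 1"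
    and card: "card (verts G) = n" and t: "t \<ge> 1"
    and adj: "\<And>u w. u \<in> verts G \<Longrightarrow> w \<in> verts G \<Longrightarrow> u \<rightarrow>\<^bsub>G\<^esub> w \<longleftrightarrow> pendant_adj v S u w"
  shows "digraph_iso G (with_proj (extremal_graph t n))"
proof -
  let ?H = "extremal_graph t n"
  let ?R = "Inr ` Inl ` {0..<n - 2 * t} :: (nat + nat + nat) set"
  have "finite S" using S(1) by (rule finite_subset) simp
  then obtain g where g: "bij_betw g S {0..<2 * t - 1}"
    using ex_bij_betw_finite_nat[of S] S(3) by auto
  have "card (verts G - S - {v}) = n - 2 * t"
    using S v card t \<open>finite S\<close> by (simp add: card_Diff_subset)
  then obtain h where h: "bij_betw h (verts G - S - {v}) {0..<n - 2 * t}"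
    using ex_bij_betw_finite_nat[of "verts G - S - {v}"] by auto
  define \<phi> :: "'a \<Rightarrow> nat + nat + nat" where
    "\<phi> u = (if u = v then Inr (Inr 0) else if u \<in> S then Inl (g u) else Inr (Inl (h u)))" for u
  have "bij_betw \<phi> (verts G) (pverts ?H)"
  proof -
    have "bij_betw \<phi> S (Inl ` {0..<2 * t - 1})"
    proof -
      have "bij_betw (Inl \<circ> g) S (Inl ` {0..<2 * t - 1})"
        by (rule bij_betw_trans[OF g]) (simp add: bij_betw_def)
      then show ?thesis
        by (rule iffD1[OF bij_betw_cong, rotated]) (use S in \<open>auto simp: \<phi>_def\<close>)
    qed
    moreover have "bij_betw \<phi> (verts G - S - {v}) ?R"
    proof -
      have "bij_betw ((Inr \<circ> Inl) \<circ> h) (verts G - S - {v}) ((Inr \<circ> Inl) ` {0..<n - 2 * t})"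
        by (rule bij_betw_trans[OF h]) (simp add: bij_betw_def inj_on_def)
      then show ?thesis
        unfolding image_comp by (rule iffD1[OF bij_betw_cong, rotated]) (auto simp: \<phi>_def)
    qed
    moreover have "bij_betw \<phi> {v} {Inr (Inr 0)}" by (simp add: \<phi>_def bij_betw_def)
    ultimately have "bij_betw \<phi> (S \<union> (verts G - S - {v}) \<union> {v})
        (Inl ` {0..<2 * t - 1} \<union> ?R \<union> {Inr (Inr 0)})"
      by (intro bij_betw_combine) auto
    moreover have "S \<union> (verts G - S - {v}) \<union> {v} = verts G" using S v by auto
    moreover have "Inl ` {0..<2 * t - 1} \<union> ?R \<union> {Inr (Inr 0)} = pverts ?H"
      by (auto simp: extremal_graph_def graph_join_def disjoint_union_def complete_graph_def)
    ultimately show ?thesis by simp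
  qed
  moreover have "u \<rightarrow>\<^bsub>G\<^esub> w \<longleftrightarrow> (\<phi> u, \<phi> w) \<in> parcs ?H" if "u \<in> verts G" "w \<in> verts G" for u w
  proof -
    have mem: "\<phi> u \<in> pverts ?H" "\<phi> w \<in> pverts ?H"
      and inj: "\<phi> u = \<phi> w \<longleftrightarrow> u = w"
      using calculation that by (auto simp: bij_betw_def inj_on_eq_iff)
    have v_iff: "\<phi> q = Inr (Inr 0) \<longleftrightarrow> q = v" for q by (simp add: \<phi>_def)
    have S_iff: "\<phi> q \<in> Inl ` {0..<2 * t - 1} \<longleftrightarrow> q \<in> S" for q
      using g S(2) by (auto simp: \<phi>_def bij_betw_def)
    show ?thesis
      unfolding adj[OF that] parcs_extremal_graph[OF mem] pendant_adj_def inj v_iff S_iff ..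
  qed
  ultimately show ?thesis
    using pair_graph_extremal_graph[of t n]
    by (intro digraph_iso_with_projI)
      (auto simp: pair_graph_def pair_digraph_def pair_fin_digraph_def)
qed

theorem theorem1p3:
  fixes t n :: nat and G :: "('a, 'b) pre_digraph"
  assumes "t \<ge> 1"
    and "graph G"
    and "Digraph_Component.connected G"
    and "card (verts G) = n"
    and "n \<ge> 4 * t^2 + 6 * t + 2"
    and "graph_spectral_radius G \<ge> graph_spectral_radius (with_proj (extremal_graph t n))"
    and "\<not> digraph_iso G (with_proj (extremal_graph t n))"
  shows "tough (real t) G"
proof (rule ccontr)
  interpret graph G by fact
  define V where "V = verts G"
  define E where "E u v \<longleftrightarrow> u \<rightarrow>\<^bsub>G\<^esub> v" for u v
  have fin: "finite V" and cV: "card V = n" by (simp_all add: V_def assms)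
  have n_ge: "4 * real t ^ 2 + 6 * real t + 2 \<le> real n"
    using of_nat_mono[OF assms(5), where 'a = real] by simp
  have n_ge_lin: "10 * t + 2 \<le> n"
    using assms(1,5) self_le_power[of t 2] by linarith
  have E_V: "u \<in> V" "v \<in> V" if "E u v" for u v using that adj_in_verts by (auto simp: E_def V_def)
  have E_sym: "E v u" if "E u v" for u v
    using that arcs_ends_symmetric[OF sym_arcs] by (simp add: E_def)
  have E_irrefl: "\<not> E v v" for v using adj_not_same by (auto simp: E_def)
  have reach: "u \<rightarrow>\<^sup>*\<^bsub>G\<^esub> v" if "u \<in> V" "v \<in> V" for u v
    using symmetric_connected_imp_strongly_connected[OF sym_arcs assms(3)] that
    by (auto simp: V_def)
  \<comment> \<open>Connectivity in the form of closed sets: applied to \<open>{v}\<close> it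
    excludes isolated vertices, and later it propagates zeros of the eigenvector.\<close>
  have E_conn: "v \<in> Z" if "u \<in> Z" "u \<in> V" "v \<in> V"
    "\<And>a b. a \<in> Z \<Longrightarrow> a \<in> V \<Longrightarrow> b \<in> V \<Longrightarrow> E a b \<Longrightarrow> b \<in> Z" for Z u v
    using reach[OF that(2,3)]
  proof (induction rule: reachable_induct)
    case base
    show ?case by (rule that(1))
  next
    case (step a b)
    then show ?case using that(4)[of a b] adj_in_verts[of a b] by (simp add: E_def V_def)
  qed
  have deg: "\<exists>u \<in> V. E v u" if v: "v \<in> V" for v
  proof (rule ccontr)
    assume no: "\<not> (\<exists>u \<in> V. E v u)"
    have "V \<subseteq> {v}" using E_conn[of v "{v}"] v no by blast
    then have "card V \<le> 1" using card_mono[of "{v}" V] by simp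
    then show False using cV n_ge_lin by simp
  qed

  \<comment> \<open>Comparing the spectral radii\<close>
  define k where "k = graph_spectral_radius G"
  have "k \<in> spectrum (adjacency_matrix G)"
    unfolding k_def graph_spectral_radius_def
    using cV n_ge_lin
    by (intro Max_in finite_spectrum_adjacency_matrix
        spectrum_adjacency_matrix_nonempty[OF assms(2)]) (auto simp: V_def)
  then have "eigenvalue (adjacency_matrix G) k" by (simp add: spectrum_def)
  then obtain x where x: "\<exists>v \<in> V. x v \<noteq> 0"
    "\<And>v. v \<in> V \<Longrightarrow> (\<Sum>u \<in> {u \<in> V. E v u}. x u) = k * x v"
    using eigenvalue_adjacency_matrix_iff[of G k] by (auto simp: E_def V_def)

  \<comment> \<open>The orders of the two cliques, as reals; the bound
    \<open>l \<ge> a + b - 1\<close> then reads \<open>l \<ge> n - 2\<close>.\<close>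
  define a where "a = 2 * real t - 1"
  define b where "b = real n - 2 * real t"
  have ab: "a \<ge> 1" "b \<ge> 1" using assms(1) n_ge_lin by (simp_all add: a_def b_def)
  have cab: "real n = a + b + 1" by (simp add: a_def b_def)
  obtain l where l: "l \<ge> a + b - 1" "l = a - 1 + b * (a / (l - b + 1)) + a / l"
    using quotient_eigenvalue_exists[OF ab] by blast
  have "l \<le> graph_spectral_radius (with_proj (extremal_graph t n))"
  proof -
    let ?H = "extremal_graph t n"
    define v :: "nat + nat + nat" where "v = Inr (Inr 0)"
    define S :: "(nat + nat + nat) set" where "S = Inl ` {0..<2 * t - 1}"
    have vS: "v \<in> pverts ?H" "v \<notin> S" "S \<subseteq> pverts ?H"
      by (auto simp: v_def S_def extremal_graph_def graph_join_def disjoint_union_def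
          complete_graph_def)
    have cards: "real (card S) = a" "real (card (pverts ?H)) = a + b + 1"
      using assms(1) n_ge_lin cab card_verts_extremal_graph[of t n]
      by (simp_all add: S_def card_image a_def)
    have finH: "finite (pverts ?H)" using cards ab by (intro card_ge_0_finite) linarith
    define z where "z = (\<lambda>u. if u = v then a / l else if u \<in> S then 1 else a / (l - b + 1))"
    note eig = pendant_adj_eigenvector[OF finH vS cards ab l z_def]
    have "(\<Sum>u \<in> {u \<in> pverts ?H. (w, u) \<in> parcs ?H}. z u) = l * z w"
      if w: "w \<in> pverts ?H" for w
    proof -
      have "{u \<in> pverts ?H. (w, u) \<in> parcs ?H} = {u \<in> pverts ?H. pendant_adj v S w u}"
        using w parcs_extremal_graph by (auto simp: v_def S_def)
      then show ?thesis using eig(2)[OF w] by simp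
    qed
    moreover have "z v \<noteq> 0" using eig(1)[OF vS(1)] by simp
    ultimately have "eigenvalue (adjacency_matrix (with_proj ?H)) l"
      using finH vS(1) by (subst eigenvalue_adjacency_matrix_iff) auto
    then show ?thesis unfolding graph_spectral_radius_def
      by (intro Max_ge finite_spectrum_adjacency_matrix) (simp add: spectrum_def)
  qed
  then have lk: "l \<le> k" using assms(6) by (simp add: k_def)
  have n2: "real n - 2 \<le> k" using lk l cab by linarith
  have "k\<^sup>2 \<le> (\<Sum>v \<in> V. real (card {u \<in> V. E v u})) - (real (card V) - 1)"
    by (rule eigenvalue_square_le_edges[OF fin E_sym E_irrefl deg x])
  moreover have "(real n - 2)\<^sup>2 \<le> k\<^sup>2" using n2 n_ge_lin by (intro power_mono) auto
  \<comment> \<open>A complete graph has degree sum \<open>n * (n - 1)\<close>, which exceeds the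
    left side by exactly \<open>2 * n - 3\<close>.\<close>
  ultimately have edges: "(real n - 2)\<^sup>2 + real n - 1 \<le> (\<Sum>v \<in> V. real (card {u \<in> V. E v u}))"
    using cV by simp

  \<comment> \<open>Counting pairs across the components of \<open>G - S\<close>\<close>
  assume "\<not> tough (real t) G"
  then obtain S where S: "S \<subseteq> V" "num_components (G \<restriction> (V - S)) > 1"
    "real (card S) < real t * real (num_components (G \<restriction> (V - S)))"
    by (auto simp: tough_def V_def not_le)
  define W where "W = V - S"
  define c where "c = num_components (G \<restriction> W)"
  obtain f :: "'a \<Rightarrow> 'a set" where cf: "card (f ` W) = c"
    and f: "\<And>u w. u \<in> W \<Longrightarrow> w \<in> W \<Longrightarrow> E u w \<Longrightarrow> f u = f w"
    using component_classes[of W] unfolding c_def E_def by blast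
  have c2: "c \<ge> 2" using S by (simp add: c_def W_def)
  have "real (card S) < real (t * c)" using S by (simp add: c_def W_def)
  \<comment> \<open>The unit gained from integrality yields \<open>m \<ge> n - t * c + 1\<close>
    and, for \<open>c = 2\<close>, at most \<open>2 * t - 1\<close> vertices in \<open>S\<close>,
    the order of the joined clique.\<close>
  then have sS: "card S + 1 \<le> t * c" by linarith
  have W: "W \<subseteq> V" "finite W" using fin by (auto simp: W_def)
  have finS: "finite S" using fin S(1) by (rule rev_finite_subset)
  have cW: "card W + card S = n"
    using S(1) fin finS cV card_mono[OF fin S(1)] by (simp add: W_def card_Diff_subset)
  have cleW: "c \<le> card W" unfolding cf[symmetric] using W by (intro card_image_le)
  define m where "m = card W"
  define p where "p A = card {w \<in> W. f w = A}" for A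
  have p1: "p A \<ge> 1" if "A \<in> f ` W" for A
    using that W by (auto simp: p_def Suc_le_eq card_gt_0_iff)
  have sum_p: "(\<Sum>A \<in> f ` W. p A) = m"
    using sum.image_gen[OF W(2), of "\<lambda>_. 1::nat" f] by (simp add: p_def m_def)
  have sum_p_real: "(\<Sum>A \<in> f ` W. real (p A)) = m"
    using sum_p by (metis of_nat_sum)
  define Q where "Q = (\<Sum>A \<in> f ` W. (real (p A))\<^sup>2)"
  have "(\<Sum>v \<in> V. card {u \<in> V. E v u}) + n + m * m \<le> n * n + (\<Sum>A \<in> f ` W. (p A)\<^sup>2)"
    using sum_degrees_le[OF fin W(1), of E f] E_irrefl f unfolding cV p_def m_def by blast
  then have "real ((\<Sum>v \<in> V. card {u \<in> V. E v u}) + n + m * m)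
      \<le> real (n * n + (\<Sum>A \<in> f ` W. (p A)\<^sup>2))"
    by (rule of_nat_mono)
  then have "(\<Sum>v \<in> V. real (card {u \<in> V. E v u})) + n + real m * m \<le> real n * n + Q"
    by (simp add: Q_def)
  with edges have MQ: "real m * m - Q \<le> 2 * real n - 3"
    by (simp add: power2_eq_square algebra_simps)

  have "c = 2"
  proof (rule ccontr)
    assume "c \<noteq> 2"
    then have c3: "c \<ge> 3" using c2 by simp
    \<comment> \<open>Subtracting this bound from \<open>m * m\<close> factors as
      \<open>(c - 1) * (2 * m - c)\<close>.\<close>
    have "Q \<le> (real m - c + 1)\<^sup>2 + c - 1"
      unfolding Q_def sum_p_real[symmetric] cf[symmetric] using W p1
      by (intro sum_squares_le_of_ge_one) force+
    then have "(real c - 1) * (2 * real m - c) \<le> real m * m - Q"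
      by (simp add: power2_eq_square algebra_simps)
    moreover have "(real c - 1) * (2 * real m - c) > 2 * real n - 3"
    proof (rule many_classes_bound[where t = "real t"])
      show "(2 * real t + 1) * (2 * real t + 2) \<le> real n"
        using n_ge by (simp add: power2_eq_square algebra_simps)
      show "real n - real t * real c + 1 \<le> real m"
        using cW sS unfolding m_def by (simp flip: of_nat_mult)
      show "real c \<le> 2 * real t + 2 \<or> 2 * real t + 3 \<le> real c"
        by (cases "c \<le> 2 * t + 2") linarith+
    qed (use assms(1) c3 cleW in \<open>auto simp: m_def\<close>)
    ultimately show False using MQ by simp
  qed
  then obtain A B where AB: "f ` W = {A, B}" "A \<noteq> B" using cf by (auto simp: card_2_iff)
  have pAB: "real (p A) + real (p B) = m" using sum_p_real AB by simp
  have QAB: "Q = (real (p A))\<^sup>2 + (real (p B))\<^sup>2" using AB by (simp add: Q_def)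
  have S_le: "card S \<le> 2 * t - 1" using sS \<open>c = 2\<close> by simp
  have "\<exists>A \<in> f ` W. p A = 1"
  proof (rule ccontr)
    assume "\<not> (\<exists>A \<in> f ` W. p A = 1)"
    then have "p A \<ge> 2" "p B \<ge> 2" using p1[of A] p1[of B] AB by force+
    \<comment> \<open>Two classes of size at least 2 leave
      \<open>2 * p A * p B \<ge> 4 * (m - 2)\<close> ordered nonadjacent pairs. With
      \<open>m \<ge> n + 1 - 2 * t\<close> this is too many once
      \<open>n \<ge> 10 * t + 2\<close>.\<close>
    then have "0 \<le> (real (p A) - 2) * (real (p B) - 2)" by (intro mult_nonneg_nonneg) auto
    then have "4 * (real m - 2) \<le> 2 * real (p A) * real (p B)"
      using pAB by (simp add: algebra_simps)
    also have "\<dots> = real m * m - Q"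
      unfolding QAB pAB[symmetric] by (simp add: power2_eq_square algebra_simps)
    also note MQ
    finally have "real (2 * m) < real (n + 4)" by simp
    then have "2 * m < n + 4" by (simp only: of_nat_less_iff)
    moreover have "n + 1 \<le> m + 2 * t" using cW S_le assms(1) unfolding m_def by linarith
    ultimately show False using n_ge_lin by linarith
  qed
  then obtain v where v: "v \<in> W" "p (f v) = 1" by blast
  have alone: "w = v" if "w \<in> W" "f w = f v" for w
  proof -
    obtain u where u: "{w \<in> W. f w = f v} = {u}"
      using v(2) unfolding p_def by (rule card_1_singletonE)
    have "w \<in> {w \<in> W. f w = f v}" "v \<in> {w \<in> W. f w = f v}" using v(1) that by simp_all
    then show ?thesis unfolding u by simp
  qed

  \<comment> \<open>Embedding \<open>G\<close> into the extremal graph and forcing equality\<close>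
  have "v \<in> V" "v \<notin> S" using v by (auto simp: W_def)
  \<comment> \<open>\<open>S\<close> may be smaller than the clique of the extremal graph. Since
    \<open>v\<close> is alone in its component, its neighbours lie in \<open>S\<close>, hence also
    in any enlargement avoiding \<open>v\<close>.\<close>
  have "\<exists>S'. S \<subseteq> S' \<and> S' \<subseteq> V - {v} \<and> card S' = 2 * t - 1"
  proof (rule exists_subset_between)
    show "2 * t - 1 \<le> card (V - {v})" using \<open>v \<in> V\<close> cV n_ge_lin by simp
  qed (use S_le S(1) \<open>v \<notin> S\<close> fin in auto)
  then obtain S' where S': "S \<subseteq> S'" "S' \<subseteq> V" "v \<notin> S'" "card S' = 2 * t - 1"
    by (auto simp: subset_Diff_insert)
  have cS': "real (card S') = a" "real (card V) = a + b + 1"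
    using S' assms(1) cab cV by (simp_all add: a_def)
  have v_nbr: "u \<in> S'" if "E v u" for u
    using that E_V[OF that] E_irrefl[of v] f[of v u] alone[of u] v S'(1) by (force simp: W_def)
  have sub: "pendant_adj v S' u w" if "E u w" for u w
    using that v_nbr E_sym E_irrefl by (auto simp: pendant_adj_def)
  define z where "z = (\<lambda>u. if u = v then a / l else if u \<in> S' then 1 else a / (l - b + 1))"
  note eig = pendant_adj_eigenvector[OF fin \<open>v \<in> V\<close> S'(3,2) cS' ab l z_def]
  have E_iff: "E u w \<longleftrightarrow> pendant_adj v S' u w" if "u \<in> V" "w \<in> V" for u w
  proof
    assume adj: "pendant_adj v S' u w"
    show "E u w"
    \<comment> \<open>\<open>l\<close> depends only on \<open>a\<close> and \<open>b\<close>, so the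
      supergraph on \<open>V\<close> has the same eigenvalue \<open>l\<close> with positive
      eigenvector \<open>z\<close>. As \<open>l \<le> k\<close>, no edge can be missing from
      \<open>G\<close>.\<close>
    proof (rule spanning_subgraph_eigenvalue_ge_imp_eq[where E = E and x = x and y = z
          and H = "pendant_adj v S'"])
      show "b \<in> Z" if "a \<in> Z" "a \<in> V" "b \<in> V"
        "\<And>c d. c \<in> Z \<Longrightarrow> c \<in> V \<Longrightarrow> d \<in> V \<Longrightarrow> E c d \<Longrightarrow> d \<in> Z" for Z a b
        using that by (rule E_conn)
      show "pendant_adj v S' c d" if "E c d" for c d using that by (rule sub)
      show "pendant_adj v S' d c" if "pendant_adj v S' c d" for c d
        using that by (auto simp: pendant_adj_def)
    qed (fact fin x eig lk that adj)+
  qed (rule sub)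

  have "digraph_iso G (with_proj (extremal_graph t n))"
    using S' \<open>v \<in> V\<close> assms(1,4) E_iff
    unfolding V_def E_def by (intro digraph_iso_extremal_graphI[of v S'])
  then show False using assms(7) by contradiction
qed

end
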